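(* Let $g$ lie in $\mathcal{C}^0\cap\mathcal{D}^p\cap\mathcal{K}^{\infty}$ for some $p\in\mathbb{N}$. Let $x>0$ be such that for every integer $q\ge p$ the function $g$ is $q$-convex or $q$-concave on $[x,\infty)$. Suppose also that the sequence $q\mapsto\Delta^qg(x)$ is bounded. Then $$J^{q+1}[\Sigma g](x)\to 0\qquad\text{as }q\to\infty\ (q\in\mathbb{N}),$$ that is, $$\Sigma g(x)=\sigma[g]+\int_1^xg(t)\,dt-\sum_{n=1}^{\infty}G_n\,\Delta^{n-1}g(x).$$ In particular, if the assumptions above are satisfied for $x=1$, then $$\sigma[g]=\sum_{n=1}^{\infty}G_n\,\Delta^{n-1}g(1).$$
   Context: $\mathbb{N}=\{0,1,2,\ldots\}$, $\mathbb{R}_+=(0,\infty)$, $\Delta f(x)=f(x+1)-f(x)$; $\mathcal{C}^0$ is the set of continuous functions $\mathbb{R}_+\to\mathbb{R}$. For an integer $p\ge -1$, a function $f\colon I\to\mathbb{R}$ on a real interval $I$ is $p$-convex (resp. $p$-concave) if for all $x_0<\cdots<x_{p+1}$ in $I$ the divided difference $f[x_0,\ldots,x_{p+1}]$ is $\ge 0$ (resp. $\le 0$), where $f[x_0,\ldots,x_n]=\sum_{k=0}^n f(x_k)/\prod_{j\ne k}(x_k-x_j)$. $\mathcal{K}^p$ is the set of functions $\mathbb{R}_+\to\mathbb{R}$ that are $p$-convex on some $[a,\infty)$ or $p$-concave on some $[a,\infty)$, and $\mathcal{K}^\infty=\bigcap_{p\ge0}\mathcal{K}^p$. $\mathcal{D}^p$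 is the set of $g\colon\mathbb{R}_+\to\mathbb{R}$ with $\Delta^pg(n)\to 0$ as $n\to\infty$ over the integers. For $g\in\mathcal{D}^p\cap\mathcal{K}^p$, the function $\Sigma g\colon\mathbb{R}_+\to\mathbb{R}$ is $$\Sigma g(x)=\lim_{n\to\infty}\Big(-g(x)+\sum_{k=1}^{n-1}(g(k)-g(x+k))+\sum_{j=1}^p\binom{x}{j}\Delta^{j-1}g(n)\Big);$$ the limit exists, does not depend on the choice of such $p$, and $\Sigma g$ is the unique solution $f\in\mathcal{K}^p$ of $\Delta f=g$ with $f(1)=0$; it is continuous if $g$ is. Gregory coefficients: $G_n=\int_0^1\binom{t}{n}\,dt$. $\sigma[g]=\int_0^1\Sigma g(t+1)\,dt$. For continuous $f\colon\mathbb{R}_+\to\mathbb{R}$ and $q\in\mathbb{N}$, $J^q[f](x)=\sum_{j=0}^{q-1}G_j\Delta^jf(x)-\int_x^{x+1}f(t)\,dt$. *)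

theory Defs
  imports "HOL-Analysis.Analysis"
begin

text \<open>
  A function on the positive reals is represented by a total function on \<^typ>\<open>real\<close>; the notions
  below do not depend on its values outside \<open>{0<..}\<close>. (In limits over \<open>n \<longlonglongrightarrow> \<infinity>\<close> the single
  index \<open>n = 0\<close> is irrelevant.)
\<close>

definition fdelta :: "(real \<Rightarrow> real) \<Rightarrow> real \<Rightarrow> real" where
  "fdelta f x = f (x + 1) - f x"

definition divided_difference :: "(real \<Rightarrow> real) \<Rightarrow> (nat \<Rightarrow> real) \<Rightarrow> nat \<Rightarrow> real" where
  "divided_difference f xs n = (\<Sum>k\<le>n. f (xs k) / (\<Prod>j\<in>{..n} - {k}. xs k - xs j))"

definition p_convex_on :: "nat \<Rightarrow> real set \<Rightarrow> (real \<Rightarrow> real) \<Rightarrow> bool" where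
  "p_convex_on p I f \<longleftrightarrow>
    (\<forall>xs. strict_mono_on {..p + 1} xs \<and> xs ` {..p + 1} \<subseteq> I \<longrightarrow> divided_difference f xs (p + 1) \<ge> 0)"

definition p_concave_on :: "nat \<Rightarrow> real set \<Rightarrow> (real \<Rightarrow> real) \<Rightarrow> bool" where
  "p_concave_on p I f \<longleftrightarrow>
    (\<forall>xs. strict_mono_on {..p + 1} xs \<and> xs ` {..p + 1} \<subseteq> I \<longrightarrow> divided_difference f xs (p + 1) \<le> 0)"

definition C0_class :: "(real \<Rightarrow> real) set" where
  "C0_class = {f. continuous_on {0<..} f}"

definition K_class :: "nat \<Rightarrow> (real \<Rightarrow> real) set" where
  "K_class p = {f. \<exists>a>0. p_convex_on p {a..} f \<or> p_concave_on p {a..} f}"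

definition K_inf_class :: "(real \<Rightarrow> real) set" where
  "K_inf_class = (\<Inter>p. K_class p)"

definition D_class :: "nat \<Rightarrow> (real \<Rightarrow> real) set" where
  "D_class p = {g. (\<lambda>n::nat. (fdelta ^^ p) g (real n)) \<longlonglongrightarrow> 0}"

definition Sigma_seq :: "nat \<Rightarrow> (real \<Rightarrow> real) \<Rightarrow> real \<Rightarrow> nat \<Rightarrow> real" where
  "Sigma_seq p g x n =
     - g x + (\<Sum>k=1..<n. g (real k) - g (x + real k))
     + (\<Sum>j=1..p. (x gchoose j) * (fdelta ^^ (j - 1)) g (real n))"

text \<open>
  The limit is the same for every \<open>p\<close> with \<open>g \<in> D_class p \<inter> K_class p\<close>; the least such \<open>p\<close> is
  used to make the definition independent of a parameter.
\<close>

definition Sigma_fun :: "(real \<Rightarrow> real) \<Rightarrow> real \<Rightarrow> real" where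
  "Sigma_fun g x = lim (Sigma_seq (LEAST p. g \<in> D_class p \<inter> K_class p) g x)"

definition Gregory :: "nat \<Rightarrow> real" where
  "Gregory n = (LBINT t=0..1. t gchoose n)"

definition sigma_const :: "(real \<Rightarrow> real) \<Rightarrow> real" where
  "sigma_const g = (LBINT t=0..1. Sigma_fun g (t + 1))"

definition J_op :: "nat \<Rightarrow> (real \<Rightarrow> real) \<Rightarrow> real \<Rightarrow> real" where
  "J_op q f x =
     (\<Sum>j<q. Gregory j * (fdelta ^^ j) f x) - (LBINT t=ereal x..ereal (x + 1). f t)"

end

theory Submission
  imports Defs "HOL-Computational_Algebra.Polynomial"
begin

text \<open>
  Put \<open>F = \<Sigma>g\<close>, so that \<open>\<Delta>F = g\<close>. Since \<open>G\<^sub>j\<close> is the integral of \<open>t gchoose j\<close> over \<open>[0, 1]\<close>,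
  the number \<open>J\<^bsup>q+1\<^esup>[F](x)\<close> is the integral over \<open>t \<in> [0, 1]\<close> of \<open>N(t) - F(x + t)\<close>, where \<open>N\<close> is the
  Newton polynomial of degree \<open>q\<close> that interpolates \<open>F\<close> at \<open>x, x + 1, \<dots>, x + q\<close>. The theorem is
  thus an estimate of an interpolation error.

  The estimate uses nothing but the sign of divided differences. Suppose that \<open>f\<close> is \<open>q\<close>-convex on
  \<open>[x, \<infinity>)\<close>, and let \<open>N\<close> and \<open>N'\<close> interpolate \<open>f\<close> at \<open>x, \<dots>, x + q\<close> and at \<open>x + 1, \<dots>, x + q + 1\<close>.
  Adding \<open>x + t\<close> with \<open>0 < t < 1\<close> to either set of nodes gives a divided difference of \<open>q + 2\<close> points,
  which is nonnegative, and the node polynomials of the two sets have opposite signs at \<open>x + t\<close>;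
  hence \<open>f (x + t)\<close> lies between \<open>N\<close> and \<open>N'\<close>. As \<open>N'\<close> and \<open>N\<close> differ by
  \<open>\<Delta>\<^bsup>q+1\<^esup>f(x) (t - 1 gchoose q)\<close>, the error is at most
  \<open>\<bar>\<Delta>\<^bsup>q+1\<^esup>f(x)\<bar> (1 - t/1)(1 - t/2)\<dots>(1 - t/q)\<close> (\<open>newton_error_bound\<close>). For \<open>f = F\<close> the first factor
  is \<open>\<bar>\<Delta>\<^bsup>q\<^esup>g(x)\<bar>\<close>, which is bounded in \<open>q\<close>, and the product is at most \<open>exp (- H\<^sub>q t)\<close> with \<open>H\<^sub>q\<close> the
  harmonic number, so its integral is at most \<open>1 / H\<^sub>q\<close>, which tends to \<open>0\<close>.

  The same error bound, now for \<open>f = g\<close> at the nodes \<open>n, \<dots>, n + p\<close>, shows that \<open>\<Sigma>g\<close> exists: consecutive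
  terms of its defining sequence differ by such an interpolation error, which is at most
  \<open>\<bar>\<Delta>\<^bsup>p+1\<^esup>g(n)\<bar>\<close> on \<open>(0, 1]\<close>. Those numbers eventually have constant sign, and without the absolute
  value they telescope, hence they are summable. This gives uniform
  convergence on \<open>(0, 1]\<close>, and the difference equation carries it to \<open>(0, m]\<close> for every \<open>m\<close>, so \<open>\<Sigma>g\<close>
  is continuous. Up to a polynomial of degree at most \<open>p\<close> the terms of the sequence are
  sums \<open>- g(x) - g(x + 1) - \<dots>\<close>, so that \<open>q\<close>-convexity of \<open>g\<close> makes \<open>\<Sigma>g\<close> \<open>q\<close>-concave for \<open>q \<ge> p\<close>, and
  conversely (\<open>p_convex_or_concave_on_Sigma_lim\<close>): the error bound does apply to \<open>F\<close>.

  Finally, the integral of \<open>F\<close> over \<open>[x, x + 1]\<close> equals \<open>\<sigma>[g]\<close> plus the integral of \<open>g\<close> from \<open>1\<close> to \<open>x\<close>,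
  again by \<open>\<Delta>F = g\<close>, so that the vanishing of \<open>J\<^bsup>q+1\<^esup>[F](x)\<close> in the limit is exactly the stated
  series expansion.
\<close>

section \<open>Divided differences\<close>

lemma divided_difference_uminus:
  "divided_difference (\<lambda>y. - f y) xs n = - divided_difference f xs n"
  by (simp add: divided_difference_def sum_negf)

lemma divided_difference_add:
  "divided_difference (\<lambda>y. f y + h y) xs n = divided_difference f xs n + divided_difference h xs n"
  by (simp add: divided_difference_def sum.distrib add_divide_distrib)

lemma divided_difference_sum:
  "divided_difference (\<lambda>y. \<Sum>i\<in>A. f i y) xs n = (\<Sum>i\<in>A. divided_difference (f i) xs n)"
  unfolding divided_difference_def by (subst sum.swap) (simp add: sum_divide_distrib)

lemma divided_difference_translate:
  "divided_difference (\<lambda>y. f (y + c)) xs n = divided_difference f (\<lambda>i. xs i + c) n"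
  by (simp add: divided_difference_def)

text \<open>
  The divided difference is the coefficient of degree \<open>n\<close> in Lagrange's formula for the polynomial
  that interpolates \<open>P\<close> at the \<open>n + 1\<close> nodes, and this polynomial is \<open>P\<close> itself.
\<close>

lemma divided_difference_poly_eq_0:
  assumes inj: "inj_on xs {..n}" and deg: "degree P < n"
  shows "divided_difference (poly P) xs n = 0"
proof -
  (* L is Lagrange's interpolation polynomial, w k the product of the linear factors at the nodes
     other than xs k, and d k the value of w k at xs k. *)
  define w where "w k = (\<Prod>j\<in>{..n} - {k}. [:- xs j, 1:])" for k
  define d where "d k = (\<Prod>j\<in>{..n} - {k}. xs k - xs j)" for k
  define L where "L = (\<Sum>k\<le>n. smult (poly P (xs k) / d k) (w k))"
  have deg_w: "degree (w k) = n" if "k \<le> n" for k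
    unfolding w_def using that by (subst degree_prod_eq_sum_degree) auto
  have coeff_w: "coeff (w k) n = 1" if "k \<le> n" for k
    using lead_coeff_prod[of "\<lambda>j. [:- xs j, 1:]" "{..n} - {k}"] deg_w[OF that]
    by (simp add: w_def)
  have poly_w: "poly (w k) (xs i) = (if i = k then d k else 0)" if "i \<le> n" "k \<le> n" for i k
    using that by (auto simp: w_def d_def poly_prod intro!: prod_zero bexI[of _ i])
  have d_nz: "d k \<noteq> 0" if "k \<le> n" for k
    using inj that by (auto simp: d_def inj_on_def)
  have "P = L"
  proof (rule poly_eqI_degree)
    have card: "card (xs ` {..n}) = Suc n" using inj by (simp add: card_image)
    show "degree P < card (xs ` {..n})" using deg card by simp
    have "degree L \<le> n"
      unfolding L_def using deg_w by (intro degree_sum_le) (auto intro: order.trans[OF degree_smult_le])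
    then show "degree L < card (xs ` {..n})" using card by simp
    fix y assume "y \<in> xs ` {..n}"
    then obtain i where i: "i \<le> n" "y = xs i" by auto
    have "poly L y = (\<Sum>k\<le>n. if k = i then poly P (xs i) else 0)"
      unfolding L_def poly_sum using i d_nz by (intro sum.cong) (auto simp: poly_w)
    then show "poly P y = poly L y" using i by simp
  qed
  moreover have "coeff L n = divided_difference (poly P) xs n"
    unfolding L_def coeff_sum divided_difference_def d_def[symmetric]
    by (intro sum.cong) (auto simp: coeff_w)
  moreover have "coeff P n = 0" using deg by (simp add: coeff_eq_0)
  ultimately show ?thesis by simp
qed

text \<open>
  Subtracting a polynomial of low degree does not change a divided difference, so if \<open>P\<close>
  interpolates \<open>f\<close> at all nodes but one, only the term of that node survives. This turns the sign of
  a divided difference into the sign of an interpolation error.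
\<close>

lemma divided_difference_eq_single_error:
  assumes inj: "inj_on xs {..n}" and deg: "degree P < n" and k: "k \<le> n"
    and agree: "\<And>i. i \<le> n \<Longrightarrow> i \<noteq> k \<Longrightarrow> f (xs i) = poly P (xs i)"
  shows "divided_difference f xs n = (f (xs k) - poly P (xs k)) / (\<Prod>j\<in>{..n} - {k}. xs k - xs j)"
proof -
  have "divided_difference f xs n = divided_difference (\<lambda>y. poly P y + (f y - poly P y)) xs n"
    by simp
  also have "\<dots> = divided_difference (\<lambda>y. f y - poly P y) xs n"
    by (subst divided_difference_add) (simp add: divided_difference_poly_eq_0[OF inj deg])
  also have "\<dots> = (\<Sum>i\<le>n. if i = k then (f (xs k) - poly P (xs k)) / (\<Prod>j\<in>{..n} - {k}. xs k - xs j) else 0)"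
    unfolding divided_difference_def by (intro sum.cong) (auto simp: agree)
  finally show ?thesis using k by simp
qed

section \<open>Newton interpolation at equidistant nodes\<close>

definition gbinomial_poly :: "real \<Rightarrow> nat \<Rightarrow> real poly" where
  "gbinomial_poly y j = smult (1 / fact j) (\<Prod>i<j. [:- (y + real i), 1:])"

lemma poly_gbinomial_poly: "poly (gbinomial_poly y j) z = (z - y) gchoose j"
  by (simp add: gbinomial_poly_def gbinomial_prod_rev poly_prod atLeast0LessThan algebra_simps
      minus_add_distrib)

lemma degree_gbinomial_poly: "degree (gbinomial_poly y j) \<le> j"
  unfolding gbinomial_poly_def by (subst degree_smult_eq, subst degree_prod_eq_sum_degree) auto

text \<open>
  Newton's forward difference formula: the argument \<open>t\<close> is the offset from the first node \<open>y\<close>, so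
  that the value approximates \<open>f (y + t)\<close>.
\<close>

definition newton_interp :: "nat \<Rightarrow> (real \<Rightarrow> real) \<Rightarrow> real \<Rightarrow> real \<Rightarrow> real" where
  "newton_interp q f y t = (\<Sum>j\<le>q. (t gchoose j) * (fdelta ^^ j) f y)"

text \<open>Pascal's rule in each term; it is the induction step for the interpolation property.\<close>

lemma newton_interp_add_1:
  "newton_interp (Suc q) f y (t + 1) = newton_interp (Suc q) f y t + newton_interp q (fdelta f) y t"
  by (simp only: newton_interp_def sum.atMost_Suc_shift gbinomial_Suc_Suc)
     (simp add: sum.distrib distrib_right funpow_swap1)

lemma newton_interp_of_nat:
  "m \<le> q \<Longrightarrow> newton_interp q f y (real m) = f (y + real m)"
proof (induction m arbitrary: q f)
  case 0
  then show ?case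
    by (simp add: newton_interp_def gbinomial_0_left if_distrib[of "\<lambda>c. c * _"] cong: if_cong)
next
  case (Suc m)
  then obtain r where q: "q = Suc r" by (cases q) auto
  have "newton_interp q f y (real m + 1) = f (y + real m) + fdelta f (y + real m)"
    using Suc unfolding q newton_interp_add_1 by simp
  then show ?case by (simp add: fdelta_def algebra_simps)
qed

definition newton_poly :: "nat \<Rightarrow> (real \<Rightarrow> real) \<Rightarrow> real \<Rightarrow> real poly" where
  "newton_poly q f y = (\<Sum>j\<le>q. smult ((fdelta ^^ j) f y) (gbinomial_poly y j))"

lemma poly_newton_poly: "poly (newton_poly q f y) z = newton_interp q f y (z - y)"
  by (simp add: newton_poly_def newton_interp_def poly_sum poly_gbinomial_poly mult.commute)

lemma degree_newton_poly: "degree (newton_poly q f y) \<le> q"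
  unfolding newton_poly_def
  by (intro degree_sum_le) (auto intro: order.trans[OF degree_smult_le] order.trans[OF degree_gbinomial_poly])

text \<open>
  This is the product of the factors \<open>1 - t / k\<close> for \<open>1 \<le> k \<le> q\<close>. The form with \<open>t - 1 gchoose q\<close> is
  the one in which it arises, from the difference of two Newton polynomials whose nodes are shifted
  by one.
\<close>

definition newton_weight :: "nat \<Rightarrow> real \<Rightarrow> real" where
  "newton_weight q t = (-1) ^ q * ((t - 1) gchoose q)"

lemma newton_weight_eq_prod: "newton_weight q t = (\<Prod>k=1..q. 1 - t / real k)"
proof (induction q)
  case (Suc q)
  have "((t - 1) gchoose Suc q) * real (Suc q) = ((t - 1) gchoose q) * (t - 1 - real q)"
    using gbinomial_mult_1[of "t - 1" q] by (simp add: algebra_simps)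
  then have "((t - 1) gchoose Suc q) = ((t - 1) gchoose q) * (t - 1 - real q) / real (Suc q)"
    by (simp add: field_simps)
  then have "newton_weight (Suc q) t = newton_weight q t * (1 - t / real (Suc q))"
    unfolding newton_weight_def by (simp only:) (simp add: field_simps)
  then show ?case using Suc.IH by simp
qed (simp add: newton_weight_def)

lemma sign_prod_diff_pos: "t < 1 \<Longrightarrow> (-1) ^ m * (\<Prod>j=1..m. t - real j) > 0"
proof (induction m)
  case (Suc m)
  have "(-1) ^ Suc m * (\<Prod>j=1..Suc m. t - real j)
      = ((-1) ^ m * (\<Prod>j=1..m. t - real j)) * (real (Suc m) - t)"
    by (simp add: algebra_simps)
  also have "\<dots> > 0" by (rule mult_pos_pos) (use Suc in auto)
  finally show ?case .
qed simp

lemma newton_weight_pos: "0 < newton_weight q t" if "t < 1" for t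
  unfolding newton_weight_eq_prod
  by (rule prod_pos) (use that in \<open>auto simp: field_simps\<close>)

lemma newton_weight_bounds:
  assumes "0 \<le> t" "t \<le> 1"
  shows "0 \<le> newton_weight q t" "newton_weight q t \<le> 1"
  unfolding newton_weight_eq_prod using assms
  by (auto intro!: prod_nonneg prod_le_1 simp: field_simps)

text \<open>
  The value \<open>f (y + t)\<close> is trapped between the polynomial \<open>P\<close> that interpolates \<open>f\<close> at
  \<open>y, \<dots>, y + q\<close> and the polynomial \<open>Q\<close> that interpolates it at \<open>y + 1, \<dots>, y + q + 1\<close>. The two bounds
  come from inserting \<open>y + t\<close> into the first and into the second set of nodes: at \<open>y + t\<close> the first
  node polynomial has the sign of \<open>(-1) ^ q\<close> and the second one the opposite sign.
\<close>

lemma newton_error_of_p_convex: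
  assumes conv: "p_convex_on q {y..} f" and t: "0 < t" "t < 1"
  defines "e \<equiv> (-1) ^ q * (f (y + t) - newton_interp q f y t)"
  shows "0 \<le> e" "e \<le> (fdelta ^^ Suc q) f y * newton_weight q t"
proof -
  define D where "D = (fdelta ^^ Suc q) f y"
  define P where "P = newton_poly q f y"
  have P_nat: "poly P (y + real m) = f (y + real m)" if "m \<le> q" for m
    using that by (simp add: P_def poly_newton_poly newton_interp_of_nat)
  have e_P: "e = (-1) ^ q * (f (y + t) - poly P (y + t))"
    by (simp add: e_def P_def poly_newton_poly)
  have sgn: "0 < (-1) ^ m * (\<Prod>j=1..m. t - real j)" for m
    using t by (intro sign_prod_diff_pos)

  (* Lower bound: y + t is inserted between the first two of the nodes y, ..., y + q. *)
  define xs where "xs j = (if j = 0 then y else if j = 1 then y + t else y + real (j - 1))" for j :: nat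
  have mono: "strict_mono_on {..q + 1} xs"
    using t by (auto simp: strict_mono_on_def xs_def)
  have "0 \<le> divided_difference f xs (q + 1)"
    using conv mono t unfolding p_convex_on_def by (auto simp: xs_def)
  also have "\<dots> = (f (xs 1) - poly P (xs 1)) / (\<Prod>j\<in>{..q + 1} - {1}. xs 1 - xs j)"
  proof (rule divided_difference_eq_single_error)
    show "inj_on xs {..q + 1}" using mono by (rule strict_mono_on_imp_inj_on)
    show "degree P < q + 1" unfolding P_def using degree_newton_poly[of q f y] by simp
    fix i assume "i \<le> q + 1" "i \<noteq> 1"
    then show "f (xs i) = poly P (xs i)"
      using P_nat[of "i - 1"] P_nat[of 0] by (auto simp: xs_def)
  qed auto
  also have "(\<Prod>j\<in>{..q + 1} - {1}. xs 1 - xs j) = t * (\<Prod>j=1..q. t - real j)"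
  proof -
    have "{..q + 1} - {1} = insert 0 (Suc ` {1..q})"
      by (auto simp: image_iff)
    then show ?thesis
      by (subst \<open>{..q + 1} - {1} = _\<close>, subst prod.insert)
        (auto simp: prod.reindex xs_def simp del: image_Suc_atLeastAtMost)
  qed
  also have "xs 1 = y + t" by (simp add: xs_def)
  finally have "0 \<le> (f (y + t) - poly P (y + t)) / (t * (\<Prod>j=1..q. t - real j))" .
  also have "\<dots> = e / (t * ((-1) ^ q * (\<Prod>j=1..q. t - real j)))"
    unfolding e_P by (simp add: mult.left_commute[of t])
  finally have "0 \<le> e / (t * ((-1) ^ q * (\<Prod>j=1..q. t - real j)))" .
  moreover have "0 < t * ((-1) ^ q * (\<Prod>j=1..q. t - real j))"
    using t sgn[of q] by (intro mult_pos_pos[OF t(1)])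
  ultimately show "0 \<le> e" using zero_le_divide_iff not_le by blast

  (* Upper bound. The correction term vanishes at y + 1, ..., y + q, and its coefficient D is the
     amount by which P misses f at y + q + 1. *)
  define Q where "Q = P + smult D (gbinomial_poly (y + 1) q)"
  have Q_nat: "poly Q (y + real m) = f (y + real m)" if "1 \<le> m" "m \<le> q + 1" for m
  proof (cases "m \<le> q")
    case True
    have "real (m - 1) gchoose q = 0"
      using that True by (subst binomial_gbinomial[symmetric]) (simp add: binomial_eq_0)
    then have "(real m - 1) gchoose q = 0" using that by (simp add: of_nat_diff)
    then show ?thesis using True by (simp add: Q_def P_nat poly_gbinomial_poly)
  next
    case False
    then have m: "m = Suc q" using that by simp
    have "newton_interp (Suc q) f y (real m) = f (y + real m)"
      using m by (intro newton_interp_of_nat) simp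
    moreover have "(real n gchoose n) = 1" for n
      using binomial_gbinomial[of n n, where 'a = real] by simp
    from this[of q] this[of "Suc q"] have "(real q gchoose q) = 1" "(1 + real q gchoose Suc q) = 1"
      by simp_all
    ultimately show ?thesis
      by (simp add: Q_def P_def poly_newton_poly poly_gbinomial_poly newton_interp_def m D_def)
  qed
  define R where "R = (\<Prod>j=1..q + 1. t - real j)"
  define ys where "ys j = (if j = 0 then y + t else y + real j)" for j :: nat
  have mono: "strict_mono_on {..q + 1} ys"
    using t by (auto simp: strict_mono_on_def ys_def)
  have "0 \<le> divided_difference f ys (q + 1)"
    using conv mono t unfolding p_convex_on_def by (auto simp: ys_def)
  also have "\<dots> = (f (ys 0) - poly Q (ys 0)) / (\<Prod>j\<in>{..q + 1} - {0}. ys 0 - ys j)"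
  proof (rule divided_difference_eq_single_error)
    show "inj_on ys {..q + 1}" using mono by (rule strict_mono_on_imp_inj_on)
    have "degree Q \<le> q" unfolding Q_def P_def
      by (intro degree_add_le degree_newton_poly order.trans[OF degree_smult_le degree_gbinomial_poly])
    then show "degree Q < q + 1" by simp
    fix i assume "i \<le> q + 1" "i \<noteq> 0"
    then show "f (ys i) = poly Q (ys i)"
      using Q_nat[of i] by (auto simp: ys_def)
  qed auto
  also have "(\<Prod>j\<in>{..q + 1} - {0}. ys 0 - ys j) = (\<Prod>j=1..q + 1. t - real j)"
    by (intro prod.cong) (auto simp: ys_def)
  also have "ys 0 = y + t" by (simp add: ys_def)
  finally have "0 \<le> (f (y + t) - poly Q (y + t)) / R" by (simp only: R_def)
  moreover have "f (y + t) - poly Q (y + t) = (-1) ^ q * (e - D * newton_weight q t)"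
    unfolding e_P Q_def newton_weight_def
    by (cases "even q") (auto simp: poly_gbinomial_poly algebra_simps)
  moreover have "(-1) ^ q * (e - D * newton_weight q t) / R
      = (D * newton_weight q t - e) / ((-1) ^ (q + 1) * R)"
    by (cases "even q") (simp_all add: diff_divide_distrib)
  ultimately have "0 \<le> (D * newton_weight q t - e) / ((-1) ^ (q + 1) * R)" by metis
  moreover have "0 < (-1) ^ (q + 1) * R" unfolding R_def by (rule sgn)
  ultimately have "0 \<le> D * newton_weight q t - e" using zero_le_divide_iff not_le by blast
  then show "e \<le> (fdelta ^^ Suc q) f y * newton_weight q t" unfolding D_def by simp
qed

lemma fdelta_funpow_uminus: "(fdelta ^^ j) (\<lambda>z. - f z) y = - (fdelta ^^ j) f y"
  by (induction j arbitrary: y) (auto simp: fdelta_def)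

lemma p_concave_on_iff_uminus: "p_concave_on q I f \<longleftrightarrow> p_convex_on q I (\<lambda>z. - f z)"
  by (simp add: p_convex_on_def p_concave_on_def divided_difference_uminus)

text \<open>
  The two-sided error bound at any interior point leaves room only if the difference is
  nonnegative.
\<close>

lemma fdelta_nonneg_of_p_convex:
  assumes "p_convex_on q {y..} f"
  shows "0 \<le> (fdelta ^^ Suc q) f y"
proof -
  have "0 \<le> (fdelta ^^ Suc q) f y * newton_weight q (1 / 2)"
    using newton_error_of_p_convex[OF assms, of "1 / 2"] by simp
  then show ?thesis using newton_weight_pos[of "1 / 2" q]
    by (simp add: zero_le_mult_iff)
qed

text \<open>
  The end points have to be included, because \<open>(0, 1]\<close> and its translates by natural numbers cover
  the positive reals. The only end point with a nonzero error is \<open>t = 1\<close> for \<open>q = 0\<close>, where the bound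
  is attained.
\<close>

lemma newton_error_bound:
  assumes conv: "p_convex_on q {y..} f \<or> p_concave_on q {y..} f" and t: "0 \<le> t" "t \<le> 1"
  shows "\<bar>f (y + t) - newton_interp q f y t\<bar> \<le> \<bar>(fdelta ^^ Suc q) f y\<bar> * newton_weight q t"
proof -
  have *: "\<bar>f (y + t) - newton_interp q f y t\<bar> \<le> \<bar>(fdelta ^^ Suc q) f y\<bar> * newton_weight q t"
    if cv: "p_convex_on q {y..} f" for f
  proof -
    consider "t = 0" | "t = 1" "q \<ge> 1" | "t = 1" "q = 0" | "0 < t" "t < 1"
      using t by linarith
    then show ?thesis
    proof cases
      case 1
      then show ?thesis using newton_interp_of_nat[of 0 q f y] newton_weight_bounds[of t q] by simp
    next
      case 2
      then show ?thesis using newton_interp_of_nat[of 1 q f y] newton_weight_bounds[of t q] by simp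
    next
      case 3
      then show ?thesis by (simp add: newton_interp_def newton_weight_def fdelta_def)
    next
      case 4
      have "\<bar>f (y + t) - newton_interp q f y t\<bar> = \<bar>(-1) ^ q * (f (y + t) - newton_interp q f y t)\<bar>"
        by (simp add: abs_mult)
      also have "\<dots> \<le> \<bar>(fdelta ^^ Suc q) f y * newton_weight q t\<bar>"
        using newton_error_of_p_convex[OF cv 4] by linarith
      also have "\<dots> = \<bar>(fdelta ^^ Suc q) f y\<bar> * newton_weight q t"
        using newton_weight_bounds[of t q] t by (simp add: abs_mult)
      finally show ?thesis .
    qed
  qed
  from conv show ?thesis
  proof
    assume "p_concave_on q {y..} f"
    then have "p_convex_on q {y..} (\<lambda>z. - f z)" by (simp add: p_concave_on_iff_uminus)
    from *[OF this] show ?thesis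
      unfolding newton_interp_def fdelta_funpow_uminus by (simp add: sum_negf abs_minus_commute)
  qed (rule *)
qed


section \<open>Convergence of the sequence defining the principal indefinite sum\<close>

text \<open>
  The increments are interpolation errors of \<open>g\<close>: passing from \<open>n\<close> to \<open>n + 1\<close> turns
  \<open>\<Delta>\<^bsup>j-1\<^esup>g(n)\<close> into \<open>\<Delta>\<^bsup>j-1\<^esup>g(n) + \<Delta>\<^bsup>j\<^esup>g(n)\<close>, and the new terms form a Newton polynomial without its
  constant term \<open>g(n)\<close>, which the first sum provides.
\<close>

lemma Sigma_seq_Suc:
  assumes "n \<ge> 1"
  shows "Sigma_seq p g x (Suc n) = Sigma_seq p g x n - (g (real n + x) - newton_interp p g (real n) x)"
proof -
  have "newton_interp p g (real n) x
      = g (real n) + (\<Sum>j=1..p. (x gchoose j) * (fdelta ^^ j) g (real n))"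
    unfolding newton_interp_def atMost_atLeast0 by (subst sum.atLeast_Suc_atMost) auto
  moreover have "(\<Sum>j=1..p. (x gchoose j) * (fdelta ^^ (j - 1)) g (real (Suc n)))
      = (\<Sum>j=1..p. (x gchoose j) * (fdelta ^^ (j - 1)) g (real n))
        + (\<Sum>j=1..p. (x gchoose j) * (fdelta ^^ j) g (real n))"
    unfolding sum.distrib[symmetric]
  proof (rule sum.cong)
    fix j assume "j \<in> {1..p}"
    then obtain i where "j = Suc i" by (cases j) auto
    then show "(x gchoose j) * (fdelta ^^ (j - 1)) g (real (Suc n))
        = (x gchoose j) * (fdelta ^^ (j - 1)) g (real n) + (x gchoose j) * (fdelta ^^ j) g (real n)"
      by (simp add: fdelta_def[of "(fdelta ^^ i) g"] algebra_simps)
  qed simp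
  ultimately show ?thesis using assms by (simp add: Sigma_seq_def add.commute)
qed

text \<open>
  The difference equation before taking the limit. It is an identity for all real \<open>x\<close>, and its last
  term vanishes in the limit. With it, convergence at \<open>x\<close> gives convergence at \<open>x + 1\<close>, also
  uniformly; at \<open>x = 0\<close> it gives \<open>\<Sigma>g(1) = 0\<close>.
\<close>

lemma Sigma_seq_add_1:
  assumes "n \<ge> 1"
  shows "Sigma_seq p g (x + 1) n
    = Sigma_seq p g x (Suc n) + g x - (x gchoose p) * (fdelta ^^ p) g (real n)"
proof -
  have "(\<Sum>k=1..<n. g (x + real k)) + g (x + real n) = (\<Sum>k=0..<n. g (x + 1 + real k)) "
    using assms by (subst sum.atLeastLessThan_Suc[symmetric])
      (simp_all add: sum.atLeast_Suc_lessThan_Suc_shift algebra_simps del: sum.op_ivl_Suc)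
  also have "\<dots> = g (x + 1) + (\<Sum>k=1..<n. g (x + 1 + real k))"
    using assms by (subst sum.atLeast_Suc_lessThan) auto
  finally have tele: "(\<Sum>k=1..<n. g (x + real k)) + g (x + real n)
    = g (x + 1) + (\<Sum>k=1..<n. g (x + 1 + real k))" .
  have "(\<Sum>j=1..p. ((x + 1) gchoose j) * (fdelta ^^ (j - 1)) g (real n))
      = (\<Sum>j=1..p. (x gchoose j) * (fdelta ^^ (j - 1)) g (real n))
        + (\<Sum>j=1..p. (x gchoose (j - 1)) * (fdelta ^^ (j - 1)) g (real n))"
    unfolding sum.distrib[symmetric]
  proof (rule sum.cong)
    fix j assume "j \<in> {1..p}"
    then obtain i where "j = Suc i" by (cases j) auto
    then show "((x + 1) gchoose j) * (fdelta ^^ (j - 1)) g (real n)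
        = (x gchoose j) * (fdelta ^^ (j - 1)) g (real n)
          + (x gchoose (j - 1)) * (fdelta ^^ (j - 1)) g (real n)"
      by (simp only: \<open>j = Suc i\<close> gbinomial_Suc_Suc) (simp add: algebra_simps)
  qed simp
  moreover have "(\<Sum>j=1..p. (x gchoose (j - 1)) * (fdelta ^^ (j - 1)) g (real n))
      = newton_interp p g (real n) x - (x gchoose p) * (fdelta ^^ p) g (real n)"
  proof -
    have "(\<Sum>j=1..p. (x gchoose (j - 1)) * (fdelta ^^ (j - 1)) g (real n))
        = (\<Sum>j<p. (x gchoose j) * (fdelta ^^ j) g (real n))"
      by (rule sum.reindex_bij_witness[of _ Suc "\<lambda>j. j - 1"]) auto
    then show ?thesis by (simp add: newton_interp_def lessThan_Suc_atMost[symmetric])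
  qed
  ultimately show ?thesis
    using tele Sigma_seq_Suc[OF assms, of p g x]
    by (simp add: Sigma_seq_def sum_subtractf algebra_simps)
qed

lemma p_convex_on_subset: "p_convex_on p I f \<Longrightarrow> J \<subseteq> I \<Longrightarrow> p_convex_on p J f"
  unfolding p_convex_on_def by blast

lemma p_concave_on_subset: "p_concave_on p I f \<Longrightarrow> J \<subseteq> I \<Longrightarrow> p_concave_on p J f"
  unfolding p_concave_on_def by blast

lemma fdelta_nonpos_of_p_concave:
  assumes "p_concave_on q {y..} f"
  shows "(fdelta ^^ Suc q) f y \<le> 0"
  using fdelta_nonneg_of_p_convex[OF assms[unfolded p_concave_on_iff_uminus]]
  unfolding fdelta_funpow_uminus by simp

text \<open>
  Without absolute values the sum telescopes, as \<open>\<Delta>\<^bsup>p\<^esup>g(n)\<close> tends to \<open>0\<close>; and eventual \<open>p\<close>-convexity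
  or \<open>p\<close>-concavity makes the sign of the terms eventually constant.
\<close>

lemma summable_abs_fdelta:
  assumes D: "g \<in> D_class p" and K: "g \<in> K_class p"
  shows "summable (\<lambda>n. \<bar>(fdelta ^^ Suc p) g (real n)\<bar>)"
proof -
  have lim: "(\<lambda>n. (fdelta ^^ p) g (real n)) \<longlonglongrightarrow> 0"
    using D by (simp add: D_class_def)
  have "(\<lambda>n. (fdelta ^^ p) g (real (Suc n)) - (fdelta ^^ p) g (real n))
    = (\<lambda>n. (fdelta ^^ Suc p) g (real n))"
    by (simp add: fdelta_def[of "(fdelta ^^ p) g"] add.commute)
  then have sm: "summable (\<lambda>n. (fdelta ^^ Suc p) g (real n))"
    using telescope_sums[OF lim] by (auto simp: sums_iff)
  obtain a where a: "p_convex_on p {a..} g \<or> p_concave_on p {a..} g"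
    using K by (auto simp: K_class_def)
  define N where "N = nat \<lceil>a\<rceil>"
  have N: "{real n..} \<subseteq> {a..}" if "n \<ge> N" for n
    using that unfolding N_def by auto
  from a show ?thesis
  proof
    assume c: "p_convex_on p {a..} g"
    have "eventually (\<lambda>n. norm \<bar>(fdelta ^^ Suc p) g (real n)\<bar> \<le> (fdelta ^^ Suc p) g (real n)) sequentially"
      using eventually_ge_at_top[of N]
    proof eventually_elim
      case (elim n)
      show ?case using fdelta_nonneg_of_p_convex[OF p_convex_on_subset[OF c N[OF elim]]] by simp
    qed
    then show ?thesis by (rule summable_comparison_test_ev) (rule sm)
  next
    assume c: "p_concave_on p {a..} g"
    have "eventually (\<lambda>n. norm \<bar>(fdelta ^^ Suc p) g (real n)\<bar> \<le> - (fdelta ^^ Suc p) g (real n)) sequentially"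
      using eventually_ge_at_top[of N]
    proof eventually_elim
      case (elim n)
      show ?case using fdelta_nonpos_of_p_concave[OF p_concave_on_subset[OF c N[OF elim]]] by simp
    qed
    then show ?thesis by (rule summable_comparison_test_ev) (rule summable_minus[OF sm])
  qed
qed

text \<open>
  Weierstrass' test for the increments. Their bound \<open>\<bar>\<Delta>\<^bsup>p+1\<^esup>g(n)\<bar>\<close> holds only for offsets in
  \<open>[0, 1]\<close>, where the weight is at most \<open>1\<close>. The index is shifted by one because the sequence is
  irregular at \<open>n = 0\<close>.
\<close>

lemma Sigma_seq_uniformly_convergent_unit_interval:
  assumes D: "g \<in> D_class p" and K: "g \<in> K_class p"
  shows "uniformly_convergent_on {0<..1} (\<lambda>n x. Sigma_seq p g x (Suc n))"
proof -
  define \<rho> where "\<rho> n x = g (real n + x) - newton_interp p g (real n) x" for n x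
  obtain a where a: "p_convex_on p {a..} g \<or> p_concave_on p {a..} g"
    using K by (auto simp: K_class_def)
  have bound: "eventually (\<lambda>n. \<forall>x\<in>{0<..1}. norm (\<rho> (Suc n) x) \<le> \<bar>(fdelta ^^ Suc p) g (real (Suc n))\<bar>)
      sequentially"
    using eventually_ge_at_top[of "nat \<lceil>a\<rceil>"]
  proof (eventually_elim, intro ballI)
    fix n x assume n: "nat \<lceil>a\<rceil> \<le> n" and x: "x \<in> {0<..1::real}"
    have "{real (Suc n)..} \<subseteq> {a..}" using n by (auto simp: nat_le_iff ceiling_le_iff)
    then have c: "p_convex_on p {real (Suc n)..} g \<or> p_concave_on p {real (Suc n)..} g"
      using a p_convex_on_subset p_concave_on_subset by blast
    have "\<bar>\<rho> (Suc n) x\<bar> \<le> \<bar>(fdelta ^^ Suc p) g (real (Suc n))\<bar> * newton_weight p x"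
      unfolding \<rho>_def by (rule newton_error_bound[OF c]) (use x in auto)
    also have "\<dots> \<le> \<bar>(fdelta ^^ Suc p) g (real (Suc n))\<bar> * 1"
      using x by (intro mult_left_mono newton_weight_bounds) auto
    finally show "norm (\<rho> (Suc n) x) \<le> \<bar>(fdelta ^^ Suc p) g (real (Suc n))\<bar>" by simp
  qed
  have "summable (\<lambda>n. \<bar>(fdelta ^^ Suc p) g (real (Suc n))\<bar>)"
    using summable_abs_fdelta[OF D K] by (subst summable_Suc_iff)
  from Weierstrass_m_test_ev[OF bound this]
  have "uniform_limit {0<..1} (\<lambda>n x. Sigma_seq p g x 1 - (\<Sum>i<n. \<rho> (Suc i) x))
      (\<lambda>x. Sigma_seq p g x 1 - (\<Sum>i. \<rho> (Suc i) x)) sequentially"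
    by (intro uniform_limit_intros)
  moreover have "Sigma_seq p g x 1 - (\<Sum>i<n. \<rho> (Suc i) x) = Sigma_seq p g x (Suc n)" for n x
  proof (induction n)
    case (Suc n)
    show ?case using Sigma_seq_Suc[of "Suc n" p g x] Suc.IH by (simp add: \<rho>_def)
  qed simp
  ultimately show ?thesis by (auto simp: uniformly_convergent_on_def)
qed

lemma continuous_on_gbinomial: "continuous_on A (\<lambda>t::real. t gchoose j)"
  unfolding gbinomial_prod_rev by (intro continuous_intros) auto

text \<open>
  Induction along the difference equation: the term that it adds is a function bounded on \<open>(0, m]\<close>
  times \<open>\<Delta>\<^bsup>p\<^esup>g(n)\<close>, so it tends to \<open>0\<close> uniformly.
\<close>

lemma Sigma_seq_uniformly_convergent:
  assumes D: "g \<in> D_class p" and K: "g \<in> K_class p"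
  shows "uniformly_convergent_on {0<..real (Suc m)} (\<lambda>n x. Sigma_seq p g x (Suc n))"
proof (induction m)
  case 0
  then show ?case using Sigma_seq_uniformly_convergent_unit_interval[OF D K] by simp
next
  case (Suc m)
  then obtain L where L: "uniform_limit {0<..real (Suc m)} (\<lambda>n x. Sigma_seq p g x (Suc n)) L sequentially"
    by (auto simp: uniformly_convergent_on_def)
  have L': "uniform_limit {0<..real (Suc m)} (\<lambda>n x. Sigma_seq p g x (Suc (Suc n))) L sequentially"
    using filterlim_compose[OF L filterlim_Suc] by simp
  have "bounded ((\<lambda>x::real. x gchoose p) ` {0..real (Suc m)})"
    by (intro compact_imp_bounded compact_continuous_image continuous_on_gbinomial compact_Icc)
  then have bd: "bounded ((\<lambda>x::real. x gchoose p) ` {0<..real (Suc m)})"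
    by (rule bounded_subset) auto
  have lim0: "(\<lambda>n. (fdelta ^^ p) g (real (Suc n))) \<longlonglongrightarrow> 0"
    using D unfolding D_class_def by (intro LIMSEQ_Suc[where f = "\<lambda>n. (fdelta ^^ p) g (real n)"]) simp
  then have "uniform_limit {0<..real (Suc m)} (\<lambda>n x. (fdelta ^^ p) g (real (Suc n))) (\<lambda>x. 0) sequentially"
    by (auto simp: uniform_limit_iff tendsto_iff elim: eventually_mono)
  then have "uniform_limit {0<..real (Suc m)}
      (\<lambda>n x. (x gchoose p) * (fdelta ^^ p) g (real (Suc n))) (\<lambda>x. (x gchoose p) * 0) sequentially"
    using bd bounded_subset[of "{0::real}" "(\<lambda>x. 0) ` {0<..real (Suc m)}"]
    by (intro uniform_lim_mult uniform_limit_const) auto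
  then have "uniform_limit {0<..real (Suc m)}
      (\<lambda>n x. Sigma_seq p g x (Suc (Suc n)) + g x - (x gchoose p) * (fdelta ^^ p) g (real (Suc n)))
      (\<lambda>x. L x + g x - (x gchoose p) * 0) sequentially"
    by (intro uniform_limit_add uniform_limit_minus uniform_limit_const L')
  then have "uniform_limit {0<..real (Suc m)} (\<lambda>n x. Sigma_seq p g (x + 1) (Suc n))
      (\<lambda>x. L x + g x - (x gchoose p) * 0) sequentially"
    by (subst Sigma_seq_add_1) auto
  then have shifted: "uniform_limit {1<..real (Suc (Suc m))} (\<lambda>n x. Sigma_seq p g ((x - 1) + 1) (Suc n))
      (\<lambda>x. L (x - 1) + g (x - 1) - ((x - 1) gchoose p) * 0) sequentially"
    by (rule uniform_limit_compose') auto
  have "uniform_limit {0<..real (Suc m)} (\<lambda>n x. Sigma_seq p g x (Suc n))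
      (\<lambda>x. lim (\<lambda>n. Sigma_seq p g x (Suc n))) sequentially"
    using Suc by (simp add: uniformly_convergent_uniform_limit_iff)
  moreover have "uniform_limit {1<..real (Suc (Suc m))} (\<lambda>n x. Sigma_seq p g x (Suc n))
      (\<lambda>x. lim (\<lambda>n. Sigma_seq p g x (Suc n))) sequentially"
    using uniformly_convergentI[OF shifted] by (simp add: uniformly_convergent_uniform_limit_iff)
  ultimately have "uniform_limit ({0<..real (Suc m)} \<union> {1<..real (Suc (Suc m))})
      (\<lambda>n x. Sigma_seq p g x (Suc n)) (\<lambda>x. lim (\<lambda>n. Sigma_seq p g x (Suc n))) sequentially"
    by (rule uniform_limit_on_Un)
  moreover have "{0<..real (Suc m)} \<union> {1<..real (Suc (Suc m))} = {0<..real (Suc (Suc m))}" by auto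
  ultimately show ?case by (simp add: uniformly_convergent_uniform_limit_iff)
qed

text \<open>
  \<open>\<Sigma>g\<close> computed with a given order \<open>p\<close>; \<^const>\<open>Sigma_fun\<close> is the case of the least admissible order.
\<close>

definition Sigma_lim :: "nat \<Rightarrow> (real \<Rightarrow> real) \<Rightarrow> real \<Rightarrow> real" where
  "Sigma_lim p g x = lim (Sigma_seq p g x)"

lemma Sigma_seq_tendsto:
  assumes D: "g \<in> D_class p" and K: "g \<in> K_class p" and x: "0 < x"
  shows "Sigma_seq p g x \<longlonglongrightarrow> Sigma_lim p g x"
proof -
  obtain m where m: "x \<le> real m" using real_arch_simple by blast
  obtain L where "uniform_limit {0<..real (Suc m)} (\<lambda>n x. Sigma_seq p g x (Suc n)) L sequentially"
    using Sigma_seq_uniformly_convergent[OF D K] by (auto simp: uniformly_convergent_on_def)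
  from tendsto_uniform_limitI[OF this] have "(\<lambda>n. Sigma_seq p g x (Suc n)) \<longlonglongrightarrow> L x"
    using x m by auto
  then have "Sigma_seq p g x \<longlonglongrightarrow> L x" by (rule LIMSEQ_imp_Suc)
  then show ?thesis unfolding Sigma_lim_def by (metis limI)
qed

text \<open>
  The sets \<open>(0, m]\<close> give continuity on the open intervals \<open>(0, m)\<close>, which cover the positive reals.
\<close>

lemma continuous_on_Sigma_lim:
  assumes D: "g \<in> D_class p" and K: "g \<in> K_class p" and cont: "continuous_on {0<..} g"
  shows "continuous_on {0<..} (Sigma_lim p g)"
proof -
  have cont_seq: "continuous_on {0<..} (\<lambda>x. Sigma_seq p g x n)" for n
    unfolding Sigma_seq_def
    by (intro continuous_intros continuous_on_gbinomial cont
        continuous_on_compose2[OF cont, where f = "\<lambda>x. x + _"]) auto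
  have cont_Ioc: "continuous_on {0<..real (Suc m)} (Sigma_lim p g)" for m
  proof -
    obtain L where L: "uniform_limit {0<..real (Suc m)} (\<lambda>n x. Sigma_seq p g x (Suc n)) L sequentially"
      using Sigma_seq_uniformly_convergent[OF D K] by (auto simp: uniformly_convergent_on_def)
    have "continuous_on {0<..real (Suc m)} L"
      by (rule uniform_limit_theorem[OF _ L])
        (auto intro!: always_eventually continuous_on_subset[OF cont_seq])
    moreover have "L x = Sigma_lim p g x" if "x \<in> {0<..real (Suc m)}" for x
      using tendsto_uniform_limitI[OF L that] LIMSEQ_Suc[OF Sigma_seq_tendsto[OF D K]] that
      by (auto intro: LIMSEQ_unique)
    ultimately show ?thesis by (rule continuous_on_eq)
  qed
  have "continuous_on {0<..<real (Suc m)} (Sigma_lim p g)" for m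
    by (rule continuous_on_subset[OF cont_Ioc[of m]]) auto
  then have "continuous_on (\<Union>m. {0<..<real (Suc m)}) (Sigma_lim p g)"
    by (intro continuous_on_open_UN) auto
  moreover have "(\<Union>m. {0<..<real (Suc m)}) = {0<..}"
    by auto (metis less_add_one linorder_not_less of_nat_Suc reals_Archimedean2 less_trans add.commute)
  ultimately show ?thesis by simp
qed

lemma Sigma_seq_add_1_tendsto:
  assumes D: "g \<in> D_class p" and L: "Sigma_seq p g x \<longlonglongrightarrow> L"
  shows "Sigma_seq p g (x + 1) \<longlonglongrightarrow> L + g x"
proof -
  have "(\<lambda>n. (fdelta ^^ p) g (real n)) \<longlonglongrightarrow> 0" using D by (simp add: D_class_def)
  then have "(\<lambda>n. Sigma_seq p g x (Suc n) + g x - (x gchoose p) * (fdelta ^^ p) g (real n))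
      \<longlonglongrightarrow> L + g x - (x gchoose p) * 0"
    by (intro tendsto_intros LIMSEQ_Suc[OF L])
  moreover have "eventually (\<lambda>n. Sigma_seq p g x (Suc n) + g x - (x gchoose p) * (fdelta ^^ p) g (real n)
      = Sigma_seq p g (x + 1) n) sequentially"
    using eventually_ge_at_top[of 1] by eventually_elim (simp add: Sigma_seq_add_1)
  ultimately show ?thesis by (simp add: filterlim_cong[OF refl refl])
qed

lemma Sigma_lim_add_1:
  assumes D: "g \<in> D_class p" and K: "g \<in> K_class p" and x: "0 < x"
  shows "Sigma_lim p g (x + 1) = Sigma_lim p g x + g x"
  using Sigma_seq_add_1_tendsto[OF D Sigma_seq_tendsto[OF D K x]]
  unfolding Sigma_lim_def by (rule limI)

text \<open>
  At \<open>x = 0\<close> every term of the sequence equals \<open>- g 0\<close>, where \<open>g 0\<close> is an arbitrary value that the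
  step from \<open>0\<close> to \<open>1\<close> cancels.
\<close>

lemma Sigma_lim_1:
  assumes D: "g \<in> D_class p"
  shows "Sigma_lim p g 1 = 0"
proof -
  have "Sigma_seq p g 0 = (\<lambda>n. - g 0)"
    by (auto simp: Sigma_seq_def gbinomial_0_left fun_eq_iff intro!: sum.neutral)
  then have "Sigma_seq p g (0 + 1) \<longlonglongrightarrow> - g 0 + g 0"
    by (intro Sigma_seq_add_1_tendsto[OF D]) simp
  then show ?thesis unfolding Sigma_lim_def by (simp add: limI)
qed

section \<open>Convexity of the principal indefinite sum\<close>

text \<open>
  As a function of \<open>x\<close>, a term of the sequence is a sum of translates of \<open>- g\<close> plus a polynomial of
  degree at most \<open>p\<close>, which a divided difference of \<open>q + 2\<close> points annihilates.
\<close>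

lemma divided_difference_Sigma_seq:
  assumes inj: "inj_on xs {..q + 1}" and "p \<le> q" and "n \<ge> 1"
  shows "divided_difference (\<lambda>x. Sigma_seq p g x n) xs (q + 1)
    = - (\<Sum>k<n. divided_difference g (\<lambda>i. xs i + real k) (q + 1))"
proof -
  define P where "P = [:\<Sum>k=1..<n. g (real k):]
    + (\<Sum>j=1..p. smult ((fdelta ^^ (j - 1)) g (real n)) (gbinomial_poly 0 j))"
  have "degree P \<le> p"
    unfolding P_def
    by (intro degree_add_le degree_sum_le)
      (auto intro!: order.trans[OF degree_smult_le] order.trans[OF degree_gbinomial_poly])
  then have deg: "degree P < q + 1" using \<open>p \<le> q\<close> by simp
  have eq: "Sigma_seq p g x n = - (\<Sum>k<n. g (x + real k)) + poly P x" for x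
  proof -
    have "(\<Sum>k<n. g (x + real k)) = g x + (\<Sum>k=1..<n. g (x + real k))"
      using \<open>n \<ge> 1\<close> unfolding lessThan_atLeast0 by (subst sum.atLeast_Suc_lessThan) auto
    then show ?thesis
      by (simp add: Sigma_seq_def P_def poly_sum poly_gbinomial_poly sum_subtractf mult.commute)
  qed
  show ?thesis
    unfolding eq divided_difference_add divided_difference_uminus divided_difference_sum
      divided_difference_translate
    unfolding divided_difference_poly_eq_0[OF inj deg] by simp
qed

lemma divided_difference_Sigma_seq_tendsto:
  assumes D: "g \<in> D_class p" and K: "g \<in> K_class p" and pos: "\<And>i. i \<le> q \<Longrightarrow> 0 < xs i"
  shows "(\<lambda>n. divided_difference (\<lambda>y. Sigma_seq p g y n) xs q)
      \<longlonglongrightarrow> divided_difference (Sigma_lim p g) xs q"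
  unfolding divided_difference_def divide_inverse
  by (intro tendsto_sum tendsto_mult_right Sigma_seq_tendsto[OF D K]) (simp add: pos)

text \<open>
  The minus sign in front of the translates exchanges convexity and concavity. All translates are to
  the right, so the half-line \<open>[x, \<infinity>)\<close> is preserved.
\<close>

lemma p_convex_or_concave_on_Sigma_lim:
  assumes D: "g \<in> D_class p" and K: "g \<in> K_class p" and "p \<le> q" and "0 < x"
    and conv: "p_convex_on q {x..} g \<or> p_concave_on q {x..} g"
  shows "p_convex_on q {x..} (Sigma_lim p g) \<or> p_concave_on q {x..} (Sigma_lim p g)"
proof -
  have lim: "(\<lambda>n. - (\<Sum>k<Suc n. divided_difference g (\<lambda>i. xs i + real k) (q + 1)))
      \<longlonglongrightarrow> divided_difference (Sigma_lim p g) xs (q + 1)"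
    if "strict_mono_on {..q + 1} xs" "xs ` {..q + 1} \<subseteq> {x..}" for xs
  proof -
    have "0 < xs i" if "i \<le> q + 1" for i
      using \<open>xs ` _ \<subseteq> _\<close> that \<open>0 < x\<close> by (force simp: image_subset_iff)
    from LIMSEQ_Suc[OF divided_difference_Sigma_seq_tendsto[OF D K, of "q + 1" xs, OF this]]
    moreover have "1 \<le> Suc n" for n by simp
    ultimately show ?thesis
      by (simp only: divided_difference_Sigma_seq[OF strict_mono_on_imp_inj_on[OF that(1)] \<open>p \<le> q\<close>])
  qed
  have shift: "strict_mono_on {..q + 1} (\<lambda>i. xs i + real k)" "(\<lambda>i. xs i + real k) ` {..q + 1} \<subseteq> {x..}"
    if "strict_mono_on {..q + 1} xs" "xs ` {..q + 1} \<subseteq> {x..}" for xs k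
    using that by (auto simp: strict_mono_on_def image_subset_iff intro: add_increasing2)
  from conv show ?thesis
  proof
    assume c: "p_convex_on q {x..} g"
    have "divided_difference (Sigma_lim p g) xs (q + 1) \<le> 0"
      if xs: "strict_mono_on {..q + 1} xs" "xs ` {..q + 1} \<subseteq> {x..}" for xs
    proof (rule LIMSEQ_le_const2[OF lim[OF xs]], intro exI allI impI)
      fix n
      have "0 \<le> divided_difference g (\<lambda>i. xs i + real k) (q + 1)" for k
        using c shift[OF xs, of k] unfolding p_convex_on_def by blast
      then show "- (\<Sum>k<Suc n. divided_difference g (\<lambda>i. xs i + real k) (q + 1)) \<le> 0"
        by (simp add: sum_nonneg del: sum.lessThan_Suc)
    qed
    then show ?thesis by (simp add: p_concave_on_def)
  next
    assume c: "p_concave_on q {x..} g"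
    have "0 \<le> divided_difference (Sigma_lim p g) xs (q + 1)"
      if xs: "strict_mono_on {..q + 1} xs" "xs ` {..q + 1} \<subseteq> {x..}" for xs
    proof (rule LIMSEQ_le_const[OF lim[OF xs]], intro exI allI impI)
      fix n
      have "divided_difference g (\<lambda>i. xs i + real k) (q + 1) \<le> 0" for k
        using c shift[OF xs, of k] unfolding p_concave_on_def by blast
      then show "0 \<le> - (\<Sum>k<Suc n. divided_difference g (\<lambda>i. xs i + real k) (q + 1))"
        by (simp add: sum_nonpos del: sum.lessThan_Suc)
    qed
    then show ?thesis by (simp add: p_convex_on_def)
  qed
qed

text \<open>
  The least admissible order \<open>p\<^sub>0\<close> is at most \<open>p\<close>, so the polynomial part of the sequence that defines
  \<open>\<Sigma>g\<close> has degree at most \<open>q\<close> for every \<open>q \<ge> p\<close>.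
\<close>

lemma Sigma_fun_eq_Sigma_lim:
  assumes "g \<in> D_class p" and "g \<in> K_class p"
  obtains p\<^sub>0 where "p\<^sub>0 \<le> p" "g \<in> D_class p\<^sub>0" "g \<in> K_class p\<^sub>0" "Sigma_fun g = Sigma_lim p\<^sub>0 g"
proof
  let ?p = "LEAST p. g \<in> D_class p \<inter> K_class p"
  have "g \<in> D_class ?p \<inter> K_class ?p" by (rule LeastI[of _ p]) (use assms in auto)
  then show "g \<in> D_class ?p" "g \<in> K_class ?p" by auto
  show "?p \<le> p" by (rule Least_le) (use assms in auto)
  show "Sigma_fun g = Sigma_lim ?p g" by (simp add: fun_eq_iff Sigma_fun_def Sigma_lim_def)
qed

lemma fdelta_funpow_cong:
  assumes "\<And>z. 0 < z \<Longrightarrow> u z = v z" and "0 < y"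
  shows "(fdelta ^^ j) u y = (fdelta ^^ j) v y"
  using assms(2) by (induction j arbitrary: y) (auto simp: fdelta_def assms(1))

section \<open>Gregory coefficients and the vanishing of the remainder\<close>

lemma LBINT_eq_integral:
  fixes f :: "real \<Rightarrow> real"
  assumes "a \<le> b" "continuous_on {a..b} f"
  shows "(LBINT t=ereal a..ereal b. f t) = integral {a..b} f"
  using assms by (intro interval_integral_eq_integral borel_integrable_atLeastAtMost')

lemma continuous_on_newton_interp: "continuous_on A (newton_interp q f y)"
  unfolding newton_interp_def by (intro continuous_intros continuous_on_gbinomial)

lemma continuous_on_newton_weight: "continuous_on A (newton_weight q)"
  unfolding newton_weight_eq_prod by (intro continuous_intros) auto

lemma integral_newton_interp:
  "integral {0..1} (newton_interp q f y) = (\<Sum>j\<le>q. Gregory j * (fdelta ^^ j) f y)"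
proof -
  have G: "Gregory j = integral {0..1} (\<lambda>t. t gchoose j)" for j
    using LBINT_eq_integral[of 0 1 "\<lambda>t. t gchoose j"] continuous_on_gbinomial
    by (simp add: Gregory_def zero_ereal_def one_ereal_def)
  show ?thesis
    unfolding newton_interp_def G
    by (subst integral_sum) (auto intro!: integrable_continuous_interval continuous_intros continuous_on_gbinomial)
qed

text \<open>\<^const>\<open>J_op\<close> is the integral of the interpolation error over \<open>[0, 1]\<close>.\<close>

lemma abs_J_op_le:
  assumes cont: "continuous_on {x..x + 1} f" and conv: "p_convex_on q {x..} f \<or> p_concave_on q {x..} f"
  shows "\<bar>J_op (q + 1) f x\<bar> \<le> \<bar>(fdelta ^^ Suc q) f x\<bar> * integral {0..1} (newton_weight q)"
proof -
  have cont': "continuous_on {0..1} (\<lambda>t. f (x + t))"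
    by (rule continuous_on_compose2[OF cont]) (auto intro!: continuous_intros)
  have int_f: "(\<lambda>t. f (x + t)) integrable_on {0..1}"
    by (rule integrable_continuous_interval) (rule cont')
  have int_N: "newton_interp q f x integrable_on {0..1}"
    by (rule integrable_continuous_interval) (rule continuous_on_newton_interp)
  have "integral {x..x + 1} f = integral {0..1} (\<lambda>t. f (x + t))"
    using integral_shift_real_ivl[of x x "x + 1" f] by (simp add: add.commute)
  moreover have "J_op (q + 1) f x = integral {0..1} (newton_interp q f x) - integral {x..x + 1} f"
    using LBINT_eq_integral[OF _ cont]
    by (simp add: J_op_def lessThan_Suc_atMost integral_newton_interp)
  ultimately have "J_op (q + 1) f x = integral {0..1} (\<lambda>t. newton_interp q f x t - f (x + t))"
    using int_N int_f by (simp add: integral_diff)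
  also have "norm \<dots> \<le> integral {0..1} (\<lambda>t. \<bar>(fdelta ^^ Suc q) f x\<bar> * newton_weight q t)"
  proof (rule integral_norm_bound_integral)
    show "(\<lambda>t. newton_interp q f x t - f (x + t)) integrable_on {0..1}"
      using int_N int_f by (rule integrable_diff)
    show "(\<lambda>t. \<bar>(fdelta ^^ Suc q) f x\<bar> * newton_weight q t) integrable_on {0..1}"
      by (intro integrable_continuous_interval continuous_on_mult_left continuous_on_newton_weight)
    show "norm (newton_interp q f x t - f (x + t)) \<le> \<bar>(fdelta ^^ Suc q) f x\<bar> * newton_weight q t"
      if "t \<in> {0..1}" for t
    proof -
      have "\<bar>f (x + t) - newton_interp q f x t\<bar> \<le> \<bar>(fdelta ^^ Suc q) f x\<bar> * newton_weight q t"
        using that by (intro newton_error_bound[OF conv]) auto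
      then show ?thesis by (simp only: real_norm_def abs_minus_commute[of "newton_interp q f x t"])
    qed
  qed
  finally show ?thesis by simp
qed

text \<open>Each factor satisfies \<open>1 - t / k \<le> exp (- t / k)\<close>, and the exponents add up to a harmonic number.\<close>

lemma newton_weight_le_exp:
  assumes "0 \<le> t" "t \<le> 1"
  shows "newton_weight q t \<le> exp (- harm q * t)"
proof -
  have "newton_weight q t \<le> (\<Prod>k=1..q. exp (- (t / real k)))"
    unfolding newton_weight_eq_prod
  proof (intro prod_mono conjI)
    fix k assume "k \<in> {1..q}"
    then show "0 \<le> 1 - t / real k" using assms by (auto simp: field_simps)
    show "1 - t / real k \<le> exp (- (t / real k))"
      using exp_ge_add_one_self[of "- (t / real k)"] by simp
  qed
  also have "\<dots> = exp (- harm q * t)"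
    by (simp add: harm_def sum_negf divide_inverse mult.commute[of _ t] flip: exp_sum sum_distrib_left)
  finally show ?thesis .
qed

lemma integral_newton_weight_le:
  assumes "q \<ge> 1"
  shows "integral {0..1} (newton_weight q) \<le> 1 / harm q"
proof -
  define h :: real where "h = harm q"
  have h: "h > 0" using assms unfolding h_def by (intro harm_pos) auto
  have "((\<lambda>t. exp (- h * t)) has_integral (- exp (- h * 1) / h - - exp (- h * 0) / h)) {0..1}"
    by (intro fundamental_theorem_of_calculus)
      (use h in \<open>auto intro!: derivative_eq_intros simp flip: has_real_derivative_iff_has_vector_derivative\<close>)
  then have int: "((\<lambda>t. exp (- h * t)) has_integral (1 - exp (- h)) / h) {0..1}"
    by (simp add: diff_divide_distrib)
  have "integral {0..1} (newton_weight q) \<le> integral {0..1} (\<lambda>t. exp (- h * t))"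
    using newton_weight_le_exp[of _ q] unfolding h_def[symmetric]
    by (intro integral_le[OF integrable_continuous_interval[OF continuous_on_newton_weight]
          has_integral_integrable[OF int]]) auto
  also have "\<dots> = (1 - exp (- h)) / h" using int by (rule integral_unique)
  also have "\<dots> \<le> 1 / h" using h by (intro divide_right_mono) auto
  finally show ?thesis by (simp add: h_def)
qed

lemma integral_newton_weight_nonneg: "0 \<le> integral {0..1} (newton_weight q)"
  by (intro Henstock_Kurzweil_Integration.integral_nonneg integrable_continuous_interval
      continuous_on_newton_weight) (auto intro: newton_weight_bounds)

lemma integral_newton_weight_tendsto_0: "(\<lambda>q. integral {0..1} (newton_weight q)) \<longlonglongrightarrow> 0"
proof (rule tendsto_sandwich)
  show "eventually (\<lambda>q. 0 \<le> integral {0..1} (newton_weight q)) sequentially"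
    by (simp add: integral_newton_weight_nonneg)
  show "eventually (\<lambda>q. integral {0..1} (newton_weight q) \<le> 1 / harm q) sequentially"
    using eventually_ge_at_top[of 1] by eventually_elim (rule integral_newton_weight_le)
  show "(\<lambda>q. 1 / harm q :: real) \<longlonglongrightarrow> 0"
    unfolding divide_inverse using tendsto_inverse_0_at_top[OF harm_at_top] by simp
qed auto

lemma J_op_tendsto_0:
  assumes cont: "continuous_on {x..x + 1} f"
    and conv: "\<And>q. q \<ge> p \<Longrightarrow> p_convex_on q {x..} f \<or> p_concave_on q {x..} f"
    and bdd: "bounded (range (\<lambda>q. (fdelta ^^ Suc q) f x))"
  shows "(\<lambda>q. J_op (q + 1) f x) \<longlonglongrightarrow> 0"
proof -
  obtain M where M: "\<And>q. \<bar>(fdelta ^^ Suc q) f x\<bar> \<le> M"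
    using bdd by (auto simp: bounded_iff)
  have "(\<lambda>q. M * integral {0..1} (newton_weight q)) \<longlonglongrightarrow> M * 0"
    by (intro tendsto_intros integral_newton_weight_tendsto_0)
  moreover have "eventually (\<lambda>q. norm (J_op (q + 1) f x) \<le> M * integral {0..1} (newton_weight q)) sequentially"
    using eventually_ge_at_top[of p]
  proof eventually_elim
    case (elim q)
    have "\<bar>(fdelta ^^ Suc q) f x\<bar> * integral {0..1} (newton_weight q)
      \<le> M * integral {0..1} (newton_weight q)"
      by (intro mult_right_mono M integral_newton_weight_nonneg)
    with abs_J_op_le[OF cont conv[OF elim]] show ?case
      unfolding real_norm_def by (rule order_trans)
  qed
  ultimately show ?thesis by (simp add: Lim_null_comparison)
qed

text \<open>
  Integrating \<open>g(t) = F(t + 1) - F(t)\<close> over \<open>[w, y]\<close> compares the integrals of \<open>F\<close> over the unit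
  intervals that start at \<open>w\<close> and at \<open>y\<close>. The case \<open>x < 1\<close> needs the comparison with the roles of \<open>1\<close>
  and \<open>x\<close> exchanged.
\<close>

lemma LBINT_unit_interval_of_fdelta:
  fixes F g :: "real \<Rightarrow> real"
  assumes cont: "continuous_on {0<..} F" and fd: "\<And>z. 0 < z \<Longrightarrow> F (z + 1) = F z + g z" and "0 < x"
  shows "(LBINT t=ereal x..ereal (x + 1). F t)
    = (LBINT t=0..1. F (t + 1)) + (LBINT t=ereal 1..ereal x. g t)"
proof -
  have main: "integral {y..y + 1} F = integral {w..w + 1} F + integral {w..y} g"
    if "0 < w" "w \<le> y" for w y
  proof -
    have int: "F integrable_on {a..b}" if "0 < a" for a b
      using that by (intro integrable_continuous_interval continuous_on_subset[OF cont]) auto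
    have int': "(\<lambda>t. F (t + 1)) integrable_on {a..b}" if "0 < a" for a b
      using that by (intro integrable_continuous_interval 
          continuous_on_compose2[OF cont, of _ "\<lambda>t. t + 1"] continuous_intros) auto
    have "integral {w..y} g = integral {w..y} (\<lambda>t. F (t + 1) - F t)"
      by (rule integral_cong) (use that fd in auto)
    also have "\<dots> = integral {w + 1..y + 1} F - integral {w..y} F"
      using int int' that integral_shift_real_ivl[of "w + 1" 1 "y + 1" F] by (simp add: integral_diff)
    finally have "integral {w..y} g = integral {w + 1..y + 1} F - integral {w..y} F" .
    moreover have "integral {w..w + 1} F + integral {w + 1..y + 1} F = integral {w..y + 1} F"
      using int that by (intro Henstock_Kurzweil_Integration.integral_combine) auto
    moreover have "integral {w..y} F + integral {y..y + 1} F = integral {w..y + 1} F"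
      using int that by (intro Henstock_Kurzweil_Integration.integral_combine) auto
    ultimately show ?thesis by linarith
  qed
  have contg: "continuous_on {a..b} g" if "0 < a" for a b
  proof -
    have "continuous_on {a..b} (\<lambda>t. F (t + 1) - F t)"
      using that by (intro continuous_intros continuous_on_compose2[OF cont, of _ "\<lambda>t. t + 1"]
          continuous_on_subset[OF cont]) auto
    then show ?thesis by (rule continuous_on_eq) (use that fd in auto)
  qed
  have unit: "(LBINT t=0..1. F (t + 1)) = integral {1..2} F"
  proof -
    have "(LBINT t=0..1. F (t + 1)) = integral {0..1} (\<lambda>t. F (t + 1))"
      unfolding zero_ereal_def one_ereal_def
      by (intro LBINT_eq_integral continuous_on_compose2[OF cont, of _ "\<lambda>t. t + 1"] continuous_intros)
        auto
    then show ?thesis using integral_shift_real_ivl[of 1 1 2 F] by simp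
  qed
  have lhs: "(LBINT t=ereal x..ereal (x + 1). F t) = integral {x..x + 1} F"
    using \<open>0 < x\<close> by (intro LBINT_eq_integral continuous_on_subset[OF cont]) auto
  show ?thesis
  proof (cases "1 \<le> x")
    case True
    then show ?thesis
      using main[of 1 x] LBINT_eq_integral[OF True contg] by (simp add: lhs unit)
  next
    case False
    then have "(LBINT t=ereal 1..ereal x. g t) = - integral {x..1} g"
      using \<open>0 < x\<close> by (subst interval_integral_endpoints_reverse) (simp add: LBINT_eq_integral contg)
    then show ?thesis
      using main[of x 1] False \<open>0 < x\<close> by (simp add: lhs unit)
  qed
qed

section \<open>The Gregory series of the principal indefinite sum\<close>

theorem proposition8p11:
  fixes g :: "real \<Rightarrow> real" and p :: nat and x :: real
  assumes "g \<in> C0_class \<inter> D_class p \<inter> K_inf_class"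
    and "x > 0"
    and "\<forall>q\<ge>p. p_convex_on q {x..} g \<or> p_concave_on q {x..} g"
    and "bounded (range (\<lambda>q. (fdelta ^^ q) g x))"
  shows "(\<lambda>q. J_op (q + 1) (Sigma_fun g) x) \<longlonglongrightarrow> 0
    \<and> summable (\<lambda>n. Gregory (Suc n) * (fdelta ^^ n) g x)
    \<and> Sigma_fun g x = sigma_const g + (LBINT t=ereal 1..ereal x. g t)
        - (\<Sum>n. Gregory (Suc n) * (fdelta ^^ n) g x)
    \<and> (x = 1 \<longrightarrow> sigma_const g = (\<Sum>n. Gregory (Suc n) * (fdelta ^^ n) g 1))"
proof -
  define F where "F = Sigma_fun g"
  have "g \<in> D_class p" "g \<in> K_class p" using assms(1) by (auto simp: K_inf_class_def)
  then obtain p\<^sub>0 where p\<^sub>0: "p\<^sub>0 \<le> p" and D: "g \<in> D_class p\<^sub>0" and K: "g \<in> K_class p\<^sub>0"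
    and F_lim: "F = Sigma_lim p\<^sub>0 g"
    unfolding F_def by (rule Sigma_fun_eq_Sigma_lim)
  have cont: "continuous_on {0<..} F"
    unfolding F_lim using assms(1) by (intro continuous_on_Sigma_lim D K) (simp add: C0_class_def)
  have F_add_1: "F (z + 1) = F z + g z" if "0 < z" for z
    unfolding F_lim using D K that by (rule Sigma_lim_add_1)
  have F_1: "F 1 = 0" unfolding F_lim using D by (rule Sigma_lim_1)
  have fdelta_F: "(fdelta ^^ Suc j) F x = (fdelta ^^ j) g x" for j
    unfolding funpow_Suc_right o_apply
    using \<open>x > 0\<close> by (intro fdelta_funpow_cong) (simp_all add: fdelta_def F_add_1)
  have conv: "p_convex_on q {x..} F \<or> p_concave_on q {x..} F" if "p \<le> q" for q
    unfolding F_lim using assms(2,3) that p\<^sub>0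
    by (intro p_convex_or_concave_on_Sigma_lim D K) auto
  have J_lim: "(\<lambda>q. J_op (q + 1) F x) \<longlonglongrightarrow> 0"
    using \<open>x > 0\<close> assms(4) unfolding fdelta_F[symmetric]
    by (intro J_op_tendsto_0[OF _ conv] continuous_on_subset[OF cont]) auto

  (* J_op (q + 1) F x is a partial sum of the series up to the constant F x - C. *)
  define C where "C = sigma_const g + (LBINT t=ereal 1..ereal x. g t)"
  have C: "(LBINT t=ereal x..ereal (x + 1). F t) = C"
    using LBINT_unit_interval_of_fdelta[OF cont F_add_1 \<open>x > 0\<close>] by (simp add: C_def sigma_const_def F_def)
  have "Gregory 0 = 1"
    by (simp add: Gregory_def zero_ereal_def one_ereal_def)
  then have J_eq: "J_op (q + 1) F x = F x + (\<Sum>n<q. Gregory (Suc n) * (fdelta ^^ n) g x) - C" for q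
    unfolding J_op_def C fdelta_F[symmetric]
    by (simp add: sum.lessThan_Suc_shift del: funpow.simps sum.lessThan_Suc)
  have "(\<lambda>q. J_op (q + 1) F x - F x + C) \<longlonglongrightarrow> 0 - F x + C"
    by (intro tendsto_intros J_lim)
  then have sums: "(\<lambda>n. Gregory (Suc n) * (fdelta ^^ n) g x) sums (C - F x)"
    unfolding J_eq sums_def by simp
  then have formula: "F x = C - (\<Sum>n. Gregory (Suc n) * (fdelta ^^ n) g x)"
    by (simp add: sums_unique[symmetric])
  have "sigma_const g = (\<Sum>n. Gregory (Suc n) * (fdelta ^^ n) g 1)" if "x = 1"
    using formula F_1 that by (simp add: C_def)
  with J_lim sums_summable[OF sums] formula show ?thesis unfolding F_def C_def by blast
qed

end
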